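(* Let $g\in\mathcal{S}(\mathbb{R})\setminus\{0\}$, $s\geq 0$ and $1\leq p\leq\infty$. Then $$\big\| \{\langle \varphi, g_{n,k}\rangle\}_{n,k\in\mathbb{Z}} \big\|_{\ell^p_w} < \infty.$$
   Context: $\mathcal{S}(\mathbb{R})$ is the Schwartz space and $\varphi(t)=e^{-\pi t^2}$. Fix lattice parameters $x_0,y_0>0$ and set $g_{n,k}(t)=e^{2\pi i k y_0 t}g(t-n x_0)$ for $n,k\in\mathbb{Z}$; $\langle\cdot,\cdot\rangle$ is the $L^2(\mathbb{R})$ inner product. The weight is $w(x,y)=\big((1+|x|)(1+|y|)\big)^s$, and for $p<\infty$, $\|\{c_{n,k}\}\|_{\ell^p_w}=\big(\sum_{n,k\in\mathbb{Z}}|c_{n,k}|^p\, w(nx_0,ky_0)^p\big)^{1/p}$, while for $p=\infty$, $\|\{c_{n,k}\}\|_{\ell^\infty_w}=\sup_{n,k\in\mathbb{Z}}|c_{n,k}|\,w(nx_0,ky_0)$. *)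

theory Defs
  imports "HOL-Analysis.Analysis"
begin

definition higher_vderiv :: "nat \<Rightarrow> (real \<Rightarrow> complex) \<Rightarrow> real \<Rightarrow> complex" where
  "higher_vderiv m f = ((\<lambda>h t. vector_derivative h (at t)) ^^ m) f"

text \<open>The first conjunct says that \<open>f\<close> is infinitely differentiable; without it
  \<^const>\<open>higher_vderiv\<close> would be unspecified.\<close>

definition schwartz_space :: "(real \<Rightarrow> complex) set" where
  "schwartz_space = {f.
     (\<forall>m t. higher_vderiv m f differentiable (at t)) \<and>
     (\<forall>j m. bounded (range (\<lambda>t. of_real t ^ j * higher_vderiv m f t)))}"

definition gaussian :: "real \<Rightarrow> complex" where
  "gaussian t = of_real (exp (- pi * t\<^sup>2))"

definition l2_inner :: "(real \<Rightarrow> complex) \<Rightarrow> (real \<Rightarrow> complex) \<Rightarrow> complex" where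
  "l2_inner f h = (LINT t|lborel. f t * cnj (h t))"

definition tf_shift ::
  "real \<Rightarrow> real \<Rightarrow> (real \<Rightarrow> complex) \<Rightarrow> int \<Rightarrow> int \<Rightarrow> real \<Rightarrow> complex" where
  "tf_shift x0 y0 g n k t =
     exp (2 * of_real pi * \<i> * of_int k * of_real y0 * of_real t) * g (t - of_int n * x0)"

definition weight :: "real \<Rightarrow> real \<Rightarrow> real \<Rightarrow> real" where
  "weight s x y = ((1 + \<bar>x\<bar>) * (1 + \<bar>y\<bar>)) powr s"

text \<open>The norm takes values in \<^typ>\<open>ennreal\<close>, where every sum and supremum exists, so that a
  divergent sequence has norm \<open>\<infinity>\<close>. Since \<open>(powr)\<close> is not available on \<^typ>\<open>ennreal\<close>,
  \<open>\<infinity> powr (1 / p) = \<infinity>\<close> is spelled out.\<close>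

definition lp_weighted_norm ::
  "ennreal \<Rightarrow> real \<Rightarrow> real \<Rightarrow> real \<Rightarrow> (int \<Rightarrow> int \<Rightarrow> complex) \<Rightarrow> ennreal" where
  "lp_weighted_norm p s x0 y0 c =
     (if p = \<infinity> then
        (SUP (n, k) \<in> UNIV. ennreal (cmod (c n k) * weight s (of_int n * x0) (of_int k * y0)))
      else
        (let q = enn2real p;
             S = (\<Sum>\<^sub>\<infinity>(n, k) \<in> UNIV.
                    ennreal (cmod (c n k) powr q *
                             weight s (of_int n * x0) (of_int k * y0) powr q))
         in if S = \<infinity> then \<infinity> else ennreal (enn2real S powr (1 / q))))"

end

theory Submission
  imports Defs "HOL-Probability.Sinc_Integral"
begin

text \<open>
  The coefficient \<open>\<langle>\<phi>, g\<^sub>n\<^sub>,\<^sub>k\<rangle>\<close> is the short-time Fourier transform of the Gaussian with window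
  \<open>g\<close>, sampled at the lattice point \<open>(n x\<^sub>0, k y\<^sub>0)\<close>. Both functions are Schwartz, so this
  transform decays faster than every power of \<open>(1 + \<bar>x\<bar>) (1 + \<bar>\<omega>\<bar>)\<close>; the weight has only
  polynomial growth, and what is left is dominated by \<open>((1 + \<bar>x\<bar>) (1 + \<bar>\<omega>\<bar>))\<^sup>-\<^sup>2\<close>, which is
  bounded and summable over the lattice.

  The decay rests on two facts. In \<open>x\<close> it comes from
  \<open>1 + \<bar>x\<bar> \<le> (1 + \<bar>t\<bar>) (1 + \<bar>t - x\<bar>)\<close>: the product \<open>f(t) g(t - x)\<close> is small wherever \<open>x\<close> is
  large, because \<open>t\<close> and \<open>t - x\<close> cannot both be small (\<open>stft_integrand_bound\<close>). In \<open>\<omega>\<close> it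
  comes from integration by parts (\<open>stft_integration_by_parts\<close>): the identity
  \<open>2 \<pi> i \<omega> (stft g f) = stft g f' + stft g' f\<close> trades each factor \<open>\<omega>\<close> for a derivative of
  \<open>f\<close> or of \<open>g\<close>. Since the Schwartz space is closed under derivatives, an induction over the
  power of \<open>\<omega>\<close>, for all pairs of Schwartz functions at once, gives every polynomial rate
  (\<open>stft_decay_monomial\<close>).
\<close>

section \<open>Schwartz functions\<close>

lemma higher_vderiv_0 [simp]: "higher_vderiv 0 f = f"
  by (simp add: higher_vderiv_def)

lemma higher_vderiv_Suc:
  "higher_vderiv (Suc m) f = (\<lambda>t. vector_derivative (higher_vderiv m f) (at t))"
  by (simp add: higher_vderiv_def)

lemma higher_vderiv_Suc_right:
  "higher_vderiv (Suc m) f = higher_vderiv m (\<lambda>t. vector_derivative f (at t))"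
  unfolding higher_vderiv_def by (simp only: funpow_Suc_right o_apply)

lemma schwartz_vector_derivative:
  assumes "f \<in> schwartz_space"
  shows "(\<lambda>t. vector_derivative f (at t)) \<in> schwartz_space"
  using assms unfolding schwartz_space_def
  by (auto simp flip: higher_vderiv_Suc_right)

lemma schwartz_has_vector_derivative:
  assumes "f \<in> schwartz_space"
  shows "(f has_vector_derivative vector_derivative f (at t)) (at t)"
proof -
  have "higher_vderiv 0 f differentiable (at t)"
    using assms unfolding schwartz_space_def by blast
  then show ?thesis
    by (simp add: vector_derivative_works)
qed

lemma schwartz_continuous:
  assumes "f \<in> schwartz_space"
  shows "continuous_on A f"
  by (meson assms schwartz_has_vector_derivative has_vector_derivative_continuous
      continuous_at_imp_continuous_on)

text \<open>The seminorms of the Schwartz space bound \<open>f\<close> and \<open>\<bar>t\<bar>\<^sup>N f\<close> separately. This inequality merges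
  two such bounds into one for the submultiplicative weight \<open>(1 + \<bar>t\<bar>)\<^sup>N\<close>.\<close>

lemma one_plus_power_le:
  fixes x :: real
  assumes "0 \<le> x"
  shows "(1 + x) ^ N \<le> 2 ^ N * (1 + x ^ N)"
proof (cases "x \<le> 1")
  case True
  have "(1 + x) ^ N \<le> 2 ^ N * 1"
    using True assms by (simp add: power_mono)
  also have "\<dots> \<le> 2 ^ N * (1 + x ^ N)"
    using assms by (intro mult_left_mono) auto
  finally show ?thesis .
next
  case False
  have "(1 + x) ^ N \<le> (2 * x) ^ N"
    using False by (intro power_mono) auto
  also have "\<dots> \<le> 2 ^ N * (1 + x ^ N)"
    by (simp add: power_mult_distrib)
  finally show ?thesis .
qed

lemma schwartz_decay:
  assumes "f \<in> schwartz_space"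
  obtains C where "\<And>t. cmod (f t) * (1 + \<bar>t\<bar>) ^ N \<le> C"
proof -
  have bdd: "bounded (range (\<lambda>t. of_real t ^ j * higher_vderiv 0 f t))" for j
    using assms unfolding schwartz_space_def by blast
  obtain A where A: "\<And>t. cmod (f t) \<le> A"
    using bdd[of 0] by (auto simp: bounded_iff)
  obtain B where B: "\<And>t. \<bar>t\<bar> ^ N * cmod (f t) \<le> B"
    using bdd[of N] by (auto simp: bounded_iff norm_mult norm_power)
  have "cmod (f t) * (1 + \<bar>t\<bar>) ^ N \<le> 2 ^ N * (A + B)" for t
  proof -
    have "cmod (f t) * (1 + \<bar>t\<bar>) ^ N \<le> cmod (f t) * (2 ^ N * (1 + \<bar>t\<bar> ^ N))"
      by (intro mult_left_mono one_plus_power_le) auto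
    also have "\<dots> = 2 ^ N * (cmod (f t) + \<bar>t\<bar> ^ N * cmod (f t))"
      by (simp add: algebra_simps)
    also have "\<dots> \<le> 2 ^ N * (A + B)"
      using A[of t] B[of t] by (intro mult_left_mono add_mono) auto
    finally show ?thesis .
  qed
  then show ?thesis by (rule that)
qed

lemma poly_gaussian_has_vector_derivative:
  "((\<lambda>t. poly P (of_real t) * gaussian t) has_vector_derivative
     poly (pderiv P - [:0, 2 * of_real pi:] * P) (of_real t) * gaussian t) (at t)"
proof -
  have g: "gaussian = (\<lambda>t. exp (- of_real pi * (of_real t)\<^sup>2))"
    by (auto simp: gaussian_def fun_eq_iff exp_of_real[symmetric])
  have "((\<lambda>z. poly P z * exp (- of_real pi * z\<^sup>2)) has_field_derivative
     poly (pderiv P - [:0, 2 * of_real pi:] * P) z * exp (- of_real pi * z\<^sup>2)) (at z)"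
    for z :: complex
    by (rule derivative_eq_intros refl poly_DERIV | simp add: algebra_simps)+
  then show ?thesis
    unfolding g by (rule has_vector_derivative_real_field)
qed

text \<open>Up to scaling the polynomials are the Hermite polynomials; any polynomial factor is
  harmless against the decay of the Gaussian.\<close>

lemma higher_vderiv_gaussian:
  "\<exists>P. higher_vderiv m gaussian = (\<lambda>t. poly P (of_real t) * gaussian t)"
proof (induction m)
  case 0
  then show ?case by (intro exI[of _ 1]) simp
next
  case (Suc m)
  then obtain P where "higher_vderiv m gaussian = (\<lambda>t. poly P (of_real t) * gaussian t)"
    by blast
  then show ?case
    using vector_derivative_at[OF poly_gaussian_has_vector_derivative[of P]]
    by (intro exI[of _ "pderiv P - [:0, 2 * of_real pi:] * P"]) (simp only: higher_vderiv_Suc)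
qed

text \<open>One term of the exponential series gives \<open>t\<^sup>2\<^sup>j \<le> j! exp (t\<^sup>2)\<close>, and \<open>\<pi> \<ge> 1\<close> lets the Gaussian
  absorb the exponential. Odd powers are reduced to even ones by \<open>\<bar>t\<bar>\<^sup>j \<le> 1 + t\<^sup>2\<^sup>j\<close>.\<close>

lemma bounded_power_times_gaussian: "bounded (range (\<lambda>t. of_real t ^ j * gaussian t))"
proof -
  have "cmod (of_real t ^ j * gaussian t) \<le> 1 + fact j" for t :: real
  proof -
    define E where "E = exp (- pi * t\<^sup>2)"
    have E: "0 < E" "E \<le> 1" by (auto simp: E_def)
    have "(t\<^sup>2) ^ j / fact j \<le> exp (t\<^sup>2)"
    proof -
      have "(\<Sum>n\<in>{j}. inverse (fact n) * (t\<^sup>2) ^ n) \<le> (\<Sum>n. inverse (fact n) * (t\<^sup>2) ^ n)"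
        using summable_exp[of "t\<^sup>2"] by (intro sum_le_suminf) auto
      then show ?thesis
        by (simp add: exp_def divide_inverse mult.commute)
    qed
    also have "\<dots> \<le> exp (pi * t\<^sup>2)"
      using pi_ge_two by (simp add: mult_le_cancel_right1)
    finally have "(t\<^sup>2) ^ j * E \<le> fact j"
      by (simp add: E_def exp_minus field_simps)
    moreover have "\<bar>t\<bar> ^ j \<le> 1 + (t\<^sup>2) ^ j"
    proof -
      have "0 \<le> (\<bar>t\<bar> ^ j - 1)\<^sup>2" by simp
      then have "2 * \<bar>t\<bar> ^ j \<le> 1 + (\<bar>t\<bar> ^ j)\<^sup>2"
        by (simp add: power2_eq_square algebra_simps)
      moreover have "(\<bar>t\<bar> ^ j)\<^sup>2 = (t\<^sup>2) ^ j"
        by (metis power2_abs power_commutes power_mult mult.commute)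
      moreover have "0 \<le> \<bar>t\<bar> ^ j" by simp
      ultimately show ?thesis by linarith
    qed
    then have "\<bar>t\<bar> ^ j * E \<le> E + (t\<^sup>2) ^ j * E"
      using E(1) mult_right_mono[of _ _ E] by (fastforce simp: distrib_right)
    ultimately have "\<bar>t\<bar> ^ j * E \<le> 1 + fact j"
      using E by linarith
    then show ?thesis
      by (simp add: norm_mult norm_power gaussian_def E_def)
  qed
  then show ?thesis by (auto simp: bounded_iff)
qed

lemma bounded_power_times_poly_gaussian:
  "bounded (range (\<lambda>t. of_real t ^ j * (poly P (of_real t) * gaussian t)))"
proof (induction P arbitrary: j)
  case 0
  then show ?case by (simp add: image_constant_conv)
next
  case (pCons a P)
  have "bounded ((*) a ` range (\<lambda>t. of_real t ^ j * gaussian t))"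
    by (intro bounded_linear_image bounded_power_times_gaussian bounded_linear_mult_right)
  then have "bounded (range (\<lambda>t. a * (of_real t ^ j * gaussian t)))"
    by (simp add: image_image)
  from bounded_plus_comp[OF this pCons.IH[of "Suc j"]] show ?case
    by (simp add: algebra_simps)
qed

lemma gaussian_schwartz: "gaussian \<in> schwartz_space"
proof -
  have "higher_vderiv m gaussian differentiable (at t) \<and>
        bounded (range (\<lambda>t. of_real t ^ j * higher_vderiv m gaussian t))" for m j t
  proof -
    obtain P where P: "higher_vderiv m gaussian = (\<lambda>t. poly P (of_real t) * gaussian t)"
      using higher_vderiv_gaussian by blast
    show ?thesis
      unfolding P
      by (intro conjI bounded_power_times_poly_gaussian
          differentiableI_vector[OF poly_gaussian_has_vector_derivative])
  qed
  then show ?thesis by (auto simp: schwartz_space_def)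
qed


section \<open>Decay of the short-time Fourier transform\<close>

text \<open>The character is written as a single exponential, already conjugated, so that
  differentiation in \<open>t\<close> brings down the constant \<open>- 2 \<pi> i \<omega>\<close>.\<close>

definition stft_integrand ::
  "(real \<Rightarrow> complex) \<Rightarrow> (real \<Rightarrow> complex) \<Rightarrow> real \<Rightarrow> real \<Rightarrow> real \<Rightarrow> complex" where
  "stft_integrand g f x \<omega> t =
     f t * cnj (g (t - x)) * exp (- (2 * of_real pi * \<i> * of_real \<omega>) * of_real t)"

definition stft ::
  "(real \<Rightarrow> complex) \<Rightarrow> (real \<Rightarrow> complex) \<Rightarrow> real \<Rightarrow> real \<Rightarrow> complex" where
  "stft g f x \<omega> = (LINT t|lborel. stft_integrand g f x \<omega> t)"

lemma l2_inner_tf_shift: "l2_inner f (tf_shift x0 y0 g n k) = stft g f (n * x0) (k * y0)"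
  unfolding l2_inner_def stft_def stft_integrand_def tf_shift_def
  by (simp add: exp_cnj algebra_simps)

lemma integrable_inverse_one_plus_square:
  "integrable lborel (\<lambda>t::real. inverse (1 + t\<^sup>2))"
  using integrable_inverse_1_plus_square by (simp add: set_integrable_def)

lemma continuous_on_stft_integrand:
  assumes "f \<in> schwartz_space" "g \<in> schwartz_space"
  shows "continuous_on A (stft_integrand g f x \<omega>)"
  unfolding stft_integrand_def
  by (intro continuous_intros schwartz_continuous assms
      continuous_on_compose2[OF schwartz_continuous[OF assms(2), of UNIV]]) auto

text \<open>Of the \<open>N + 2\<close> powers of decay of \<open>f\<close>, \<open>N\<close> are spent together with those of \<open>g\<close> on the factor
  \<open>(1 + \<bar>x\<bar>)\<^sup>N\<close>; the other two leave a majorant that is integrable in \<open>t\<close> and independent of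
  \<open>x\<close> and \<open>\<omega>\<close>.\<close>

lemma stft_integrand_bound:
  assumes "f \<in> schwartz_space" "g \<in> schwartz_space"
  obtains C where
    "\<And>x \<omega> t. cmod (stft_integrand g f x \<omega> t) * (1 + \<bar>x\<bar>) ^ N \<le> C * inverse (1 + t\<^sup>2)"
proof -
  obtain A where A: "\<And>t. cmod (f t) * (1 + \<bar>t\<bar>) ^ (N + 2) \<le> A"
    using schwartz_decay[OF assms(1)] by blast
  obtain B where B: "\<And>t. cmod (g t) * (1 + \<bar>t\<bar>) ^ N \<le> B"
    using schwartz_decay[OF assms(2)] by blast
  have A0: "0 \<le> A" by (rule order_trans[OF _ A[of 0]]) simp
  have "cmod (stft_integrand g f x \<omega> t) * (1 + \<bar>x\<bar>) ^ N \<le> (A * B) * inverse (1 + t\<^sup>2)"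
    for x \<omega> t
  proof -
    have "1 + \<bar>x\<bar> \<le> (1 + \<bar>t\<bar>) * (1 + \<bar>t - x\<bar>)"
    proof -
      have "0 \<le> \<bar>t\<bar> * \<bar>t - x\<bar>" by simp
      moreover have "(1 + \<bar>t\<bar>) * (1 + \<bar>t - x\<bar>) = 1 + \<bar>t\<bar> + \<bar>t - x\<bar> + \<bar>t\<bar> * \<bar>t - x\<bar>"
        by (simp add: algebra_simps)
      ultimately show ?thesis by linarith
    qed
    then have w: "(1 + \<bar>x\<bar>) ^ N \<le> (1 + \<bar>t\<bar>) ^ N * (1 + \<bar>t - x\<bar>) ^ N"
      by (metis power_mono power_mult_distrib abs_ge_zero add_nonneg_nonneg zero_le_one)
    have sq: "1 + t\<^sup>2 \<le> (1 + \<bar>t\<bar>)\<^sup>2" by (simp add: power2_sum)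
    have "cmod (stft_integrand g f x \<omega> t) * (1 + \<bar>x\<bar>) ^ N * (1 + t\<^sup>2)
       = cmod (f t) * cmod (g (t - x)) * ((1 + \<bar>x\<bar>) ^ N * (1 + t\<^sup>2))"
      by (simp add: stft_integrand_def norm_mult)
    also have "\<dots> \<le> cmod (f t) * cmod (g (t - x)) *
                     (((1 + \<bar>t\<bar>) ^ N * (1 + \<bar>t - x\<bar>) ^ N) * (1 + \<bar>t\<bar>)\<^sup>2)"
      using w sq by (intro mult_left_mono mult_mono) auto
    also have "\<dots> = (cmod (f t) * (1 + \<bar>t\<bar>) ^ (N + 2)) *
                     (cmod (g (t - x)) * (1 + \<bar>t - x\<bar>) ^ N)"
      by (simp add: power_add power2_eq_square mult_ac)
    also have "\<dots> \<le> A * B"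
      using A B A0 by (intro mult_mono) auto
    finally have *: "cmod (stft_integrand g f x \<omega> t) * (1 + \<bar>x\<bar>) ^ N * (1 + t\<^sup>2) \<le> A * B" .
    have "0 < 1 + t\<^sup>2" by (simp add: add_pos_nonneg)
    with * show ?thesis by (simp add: field_simps)
  qed
  then show ?thesis by (rule that)
qed

lemma integrable_stft_integrand:
  assumes "f \<in> schwartz_space" "g \<in> schwartz_space"
  shows "integrable lborel (stft_integrand g f x \<omega>)"
proof -
  obtain C where
    C: "\<And>x \<omega> t. cmod (stft_integrand g f x \<omega> t) * (1 + \<bar>x\<bar>) ^ 0 \<le> C * inverse (1 + t\<^sup>2)"
    using stft_integrand_bound[OF assms] by blast
  show ?thesis
  proof (rule Bochner_Integration.integrable_bound)
    show "integrable lborel (\<lambda>t. C * inverse (1 + t\<^sup>2))"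
      by (intro integrable_mult_right integrable_inverse_one_plus_square)
    show "stft_integrand g f x \<omega> \<in> borel_measurable lborel"
      using borel_measurable_continuous_onI[OF continuous_on_stft_integrand[OF assms]] by simp
    show "AE t in lborel. cmod (stft_integrand g f x \<omega> t) \<le> norm (C * inverse (1 + t\<^sup>2))"
    proof (rule AE_I2)
      show "cmod (stft_integrand g f x \<omega> t) \<le> norm (C * inverse (1 + t\<^sup>2))" for t
        using order_trans[OF C[of x \<omega> t] abs_ge_self] by simp
    qed
  qed
qed

lemma tendsto_stft_integrand:
  assumes "f \<in> schwartz_space" "g \<in> schwartz_space"
    and F: "F \<le> at_infinity"
  shows "(stft_integrand g f x \<omega> \<longlongrightarrow> 0) F"
proof -
  obtain C where
    C: "\<And>x \<omega> t. cmod (stft_integrand g f x \<omega> t) * (1 + \<bar>x\<bar>) ^ 0 \<le> C * inverse (1 + t\<^sup>2)"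
    using stft_integrand_bound[OF assms(1,2)] by blast
  have "filterlim (\<lambda>t::real. \<bar>t\<bar>) at_top F"
    using filterlim_mono[OF filterlim_norm_at_top order_refl F] by (simp add: filterlim_def real_norm_def[abs_def])
  then have "filterlim (\<lambda>t::real. 1 + \<bar>t\<bar>\<^sup>2) at_top F"
    by (intro filterlim_tendsto_add_at_top[OF tendsto_const] filterlim_pow_at_top) auto
  then have "((\<lambda>t. C * inverse (1 + t\<^sup>2)) \<longlongrightarrow> C * 0) F"
    by (intro tendsto_mult_left tendsto_inverse_0_at_top) simp
  then have lim: "((\<lambda>t. C * inverse (1 + t\<^sup>2)) \<longlongrightarrow> 0) F"
    by simp
  have "cmod (stft_integrand g f x \<omega> t) \<le> C * inverse (1 + t\<^sup>2)" for t
    using C[of x \<omega> t] by simp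
  then show ?thesis
    by (intro Lim_null_comparison[OF _ lim] always_eventually allI)
qed

lemma integral_vector_derivative_eq_0:
  fixes F f :: "real \<Rightarrow> 'a::euclidean_space"
  assumes "\<And>t. (F has_vector_derivative f t) (at t)" "continuous_on UNIV f"
    and "integrable lborel f" "(F \<longlongrightarrow> 0) at_bot" "(F \<longlongrightarrow> 0) at_top"
  shows "(LINT t|lborel. f t) = 0"
proof -
  have "(LBINT t=-\<infinity>..\<infinity>. f t) = 0 - 0"
    by (rule interval_integral_FTC_integrable[where F = F])
      (use assms in \<open>auto simp: ereal_tendsto_simps set_integrable_def continuous_on_eq_continuous_at\<close>)
  then show ?thesis
    by (simp add: interval_lebesgue_integral_def set_lebesgue_integral_def)
qed

text \<open>The integrand of \<open>stft g f\<close> vanishes at both ends of the line, so its derivative has integral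
  zero; the product rule splits that derivative into the three transforms.\<close>

lemma stft_integration_by_parts:
  assumes f: "f \<in> schwartz_space" and g: "g \<in> schwartz_space"
  shows "2 * of_real pi * \<i> * of_real \<omega> * stft g f x \<omega> =
    stft g (\<lambda>t. vector_derivative f (at t)) x \<omega> + stft (\<lambda>t. vector_derivative g (at t)) f x \<omega>"
proof -
  define f' g' c where "f' = (\<lambda>t. vector_derivative f (at t))"
    and "g' = (\<lambda>t. vector_derivative g (at t))" and "c = 2 * of_real pi * \<i> * of_real \<omega>"
  have f': "f' \<in> schwartz_space" and g': "g' \<in> schwartz_space"
    using f g by (auto simp: f'_def g'_def schwartz_vector_derivative)
  let ?h = "\<lambda>t. stft_integrand g f' x \<omega> t + stft_integrand g' f x \<omega> t
                 - c * stft_integrand g f x \<omega> t"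
  have df: "(f has_vector_derivative f' t) (at t)" for t
    unfolding f'_def by (rule schwartz_has_vector_derivative[OF f])
  have dg: "((\<lambda>t. cnj (g (t - x))) has_vector_derivative cnj (g' (t - x))) (at t)" for t
  proof -
    have "((g \<circ> (\<lambda>t. t - x)) has_vector_derivative 1 *\<^sub>R g' (t - x)) (at t)"
      unfolding g'_def
      by (intro vector_diff_chain_at schwartz_has_vector_derivative g)
         (auto intro!: derivative_eq_intros)
    then show ?thesis
      by (auto simp: o_def intro: has_vector_derivative_cnj)
  qed
  have de: "((\<lambda>t. exp (- c * of_real t)) has_vector_derivative - c * exp (- c * of_real t)) (at t)"
    for t :: real
    by (rule has_vector_derivative_real_field[where f = "\<lambda>z. exp (- c * z)"])
       (auto intro!: derivative_eq_intros)
  have "(stft_integrand g f x \<omega> has_vector_derivative ?h t) (at t)" for t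
    unfolding stft_integrand_def c_def[symmetric]
    by (rule has_vector_derivative_eq_rhs[OF has_vector_derivative_mult[OF
            has_vector_derivative_mult[OF df dg] de]]) (simp add: algebra_simps)
  then have "(LINT t|lborel. ?h t) = 0"
  proof (rule integral_vector_derivative_eq_0)
    show "continuous_on UNIV ?h"
      by (intro continuous_intros continuous_on_stft_integrand f g f' g')
    show "integrable lborel ?h"
      by (intro Bochner_Integration.integrable_add Bochner_Integration.integrable_diff
          integrable_mult_right integrable_stft_integrand f g f' g')
  qed (intro tendsto_stft_integrand f g at_top_le_at_infinity at_bot_le_at_infinity)+
  moreover have "(LINT t|lborel. ?h t) = stft g f' x \<omega> + stft g' f x \<omega> - c * stft g f x \<omega>"
    unfolding stft_def by (simp add: integrable_stft_integrand f g f' g')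
  ultimately show ?thesis
    by (simp add: f'_def g'_def c_def)
qed

text \<open>The induction is over the power of \<open>\<omega>\<close>, with \<open>f\<close> and \<open>g\<close> arbitrary because the step passes to
  \<open>f'\<close> and \<open>g'\<close>. The factor \<open>2 \<pi>\<close> from integration by parts exceeds \<open>1\<close> and is dropped.\<close>

lemma stft_decay_monomial:
  assumes "f \<in> schwartz_space" "g \<in> schwartz_space"
  shows "\<exists>C. \<forall>x \<omega>. \<bar>\<omega>\<bar> ^ M * cmod (stft g f x \<omega>) * (1 + \<bar>x\<bar>) ^ N \<le> C"
  using assms
proof (induction M arbitrary: f g)
  case 0
  obtain C where
    C: "\<And>x \<omega> t. cmod (stft_integrand g f x \<omega> t) * (1 + \<bar>x\<bar>) ^ N \<le> C * inverse (1 + t\<^sup>2)"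
    using stft_integrand_bound[OF 0] by blast
  have "cmod (stft g f x \<omega>) * (1 + \<bar>x\<bar>) ^ N \<le> (LINT t|lborel. C * inverse (1 + t\<^sup>2))" for x \<omega>
  proof -
    have "cmod (stft g f x \<omega>) * (1 + \<bar>x\<bar>) ^ N
        = cmod (LINT t|lborel. of_real ((1 + \<bar>x\<bar>) ^ N) * stft_integrand g f x \<omega> t)"
      by (simp add: stft_def norm_mult norm_power abs_of_nonneg flip: of_real_add)
    also have "\<dots> \<le> (LINT t|lborel. C * inverse (1 + t\<^sup>2))"
    proof (rule Bochner_Integration.integral_norm_bound_integral)
      fix t
      show "cmod (of_real ((1 + \<bar>x\<bar>) ^ N) * stft_integrand g f x \<omega> t) \<le> C * inverse (1 + t\<^sup>2)"
        using C[of x \<omega> t]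
        by (simp add: norm_mult norm_power abs_of_nonneg mult.commute flip: of_real_add)
    qed (intro integrable_mult_right integrable_stft_integrand 0
        integrable_inverse_one_plus_square)+
    finally show ?thesis .
  qed
  then show ?case by auto
next
  case (Suc M)
  let ?f' = "\<lambda>t. vector_derivative f (at t)" and ?g' = "\<lambda>t. vector_derivative g (at t)"
  obtain A where A: "\<And>x \<omega>. \<bar>\<omega>\<bar> ^ M * cmod (stft g ?f' x \<omega>) * (1 + \<bar>x\<bar>) ^ N \<le> A"
    using Suc.IH[OF schwartz_vector_derivative[OF Suc.prems(1)] Suc.prems(2)] by blast
  obtain B where B: "\<And>x \<omega>. \<bar>\<omega>\<bar> ^ M * cmod (stft ?g' f x \<omega>) * (1 + \<bar>x\<bar>) ^ N \<le> B"
    using Suc.IH[OF Suc.prems(1) schwartz_vector_derivative[OF Suc.prems(2)]] by blast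
  have "\<bar>\<omega>\<bar> ^ Suc M * cmod (stft g f x \<omega>) * (1 + \<bar>x\<bar>) ^ N \<le> A + B" for x \<omega>
  proof -
    have "\<bar>\<omega>\<bar> * cmod (stft g f x \<omega>) \<le> 2 * pi * (\<bar>\<omega>\<bar> * cmod (stft g f x \<omega>))"
      using pi_ge_two mult_right_mono[of 1 "2 * pi" "\<bar>\<omega>\<bar> * cmod (stft g f x \<omega>)"] by simp
    also have "\<dots> = cmod (2 * of_real pi * \<i> * of_real \<omega> * stft g f x \<omega>)"
      by (simp add: norm_mult)
    also have "\<dots> \<le> cmod (stft g ?f' x \<omega>) + cmod (stft ?g' f x \<omega>)"
      unfolding stft_integration_by_parts[OF Suc.prems] by (rule norm_triangle_ineq)
    finally have "\<bar>\<omega>\<bar> ^ M * (1 + \<bar>x\<bar>) ^ N * (\<bar>\<omega>\<bar> * cmod (stft g f x \<omega>))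
        \<le> \<bar>\<omega>\<bar> ^ M * (1 + \<bar>x\<bar>) ^ N * (cmod (stft g ?f' x \<omega>) + cmod (stft ?g' f x \<omega>))"
      by (intro mult_left_mono) auto
    then show ?thesis
      using A[where x = x and \<omega> = \<omega>] B[where x = x and \<omega> = \<omega>] by (simp add: algebra_simps)
  qed
  then show ?case by blast
qed

lemma stft_decay:
  assumes "f \<in> schwartz_space" "g \<in> schwartz_space"
  obtains C where "\<And>x \<omega>. cmod (stft g f x \<omega>) * ((1 + \<bar>x\<bar>) * (1 + \<bar>\<omega>\<bar>)) ^ N \<le> C"
proof -
  obtain A where A: "\<And>x \<omega>. \<bar>\<omega>\<bar> ^ 0 * cmod (stft g f x \<omega>) * (1 + \<bar>x\<bar>) ^ N \<le> A"
    using stft_decay_monomial[OF assms] by blast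
  obtain B where B: "\<And>x \<omega>. \<bar>\<omega>\<bar> ^ N * cmod (stft g f x \<omega>) * (1 + \<bar>x\<bar>) ^ N \<le> B"
    using stft_decay_monomial[OF assms] by blast
  have "cmod (stft g f x \<omega>) * ((1 + \<bar>x\<bar>) * (1 + \<bar>\<omega>\<bar>)) ^ N \<le> 2 ^ N * (A + B)" for x \<omega>
  proof -
    have "cmod (stft g f x \<omega>) * ((1 + \<bar>x\<bar>) * (1 + \<bar>\<omega>\<bar>)) ^ N
        \<le> cmod (stft g f x \<omega>) * ((1 + \<bar>x\<bar>) ^ N * (2 ^ N * (1 + \<bar>\<omega>\<bar> ^ N)))"
      unfolding power_mult_distrib by (intro mult_left_mono one_plus_power_le) auto
    also have "\<dots> = 2 ^ N * (\<bar>\<omega>\<bar> ^ 0 * cmod (stft g f x \<omega>) * (1 + \<bar>x\<bar>) ^ N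
                    + \<bar>\<omega>\<bar> ^ N * cmod (stft g f x \<omega>) * (1 + \<bar>x\<bar>) ^ N)"
      by (simp add: algebra_simps)
    also have "\<dots> \<le> 2 ^ N * (A + B)"
      using A B by (intro mult_left_mono add_mono) auto
    finally show ?thesis .
  qed
  then show ?thesis by (rule that)
qed

text \<open>Two powers more than the weight needs are taken from the rapid decay, to make the remaining
  bound summable over a lattice in the plane.\<close>

lemma weighted_stft_decay:
  assumes "f \<in> schwartz_space" "g \<in> schwartz_space"
  obtains C where
    "\<And>x \<omega>. cmod (stft g f x \<omega>) * weight s x \<omega> \<le> C * inverse (((1 + \<bar>x\<bar>) * (1 + \<bar>\<omega>\<bar>))\<^sup>2)"
proof -
  define N where "N = nat \<lceil>s\<rceil>"
  obtain C where C: "\<And>x \<omega>. cmod (stft g f x \<omega>) * ((1 + \<bar>x\<bar>) * (1 + \<bar>\<omega>\<bar>)) ^ (N + 2) \<le> C"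
    using stft_decay[OF assms] by blast
  have "cmod (stft g f x \<omega>) * weight s x \<omega> \<le> C * inverse (((1 + \<bar>x\<bar>) * (1 + \<bar>\<omega>\<bar>))\<^sup>2)" for x \<omega>
  proof -
    define W where "W = (1 + \<bar>x\<bar>) * (1 + \<bar>\<omega>\<bar>)"
    have W: "1 \<le> W"
      unfolding W_def using mult_mono[of 1 "1 + \<bar>x\<bar>" 1 "1 + \<bar>\<omega>\<bar>"] by simp
    have "s \<le> real N" unfolding N_def by linarith
    then have "W powr s \<le> W ^ N"
      using W powr_mono[of s "real N" W] by (simp add: powr_realpow)
    then have "cmod (stft g f x \<omega>) * W powr s * W\<^sup>2 \<le> cmod (stft g f x \<omega>) * W ^ N * W\<^sup>2"
      by (intro mult_left_mono mult_right_mono) auto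
    also have "\<dots> \<le> C"
      using C[of x \<omega>, folded W_def] by (simp only: power_add mult.assoc)
    finally show ?thesis
      using W by (simp add: weight_def flip: W_def) (simp add: field_simps)
  qed
  then show ?thesis by (rule that)
qed


section \<open>Summation over the lattice\<close>

lemma summable_on_inverse_square_int:
  fixes a :: real
  assumes "a > 0"
  shows "(\<lambda>n::int. inverse ((1 + \<bar>of_int n * a\<bar>)\<^sup>2)) summable_on UNIV" (is "?u summable_on _")
proof -
  have "summable (\<lambda>j. norm (inverse ((1 + real j * a)\<^sup>2)))"
  proof (rule summable_comparison_test')
    show "summable (\<lambda>j. inverse (a\<^sup>2) * inverse (real j ^ 2))"
      by (intro summable_mult inverse_power_summable) auto
    fix j :: nat assume "j \<ge> 1"
    then have "0 < real j * a" using assms by (intro mult_pos_pos) auto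
    then have "inverse ((1 + real j * a)\<^sup>2) \<le> inverse ((real j * a)\<^sup>2)"
      by (intro le_imp_inverse_le power_mono zero_less_power) linarith+
    then show "norm (norm (inverse ((1 + real j * a)\<^sup>2))) \<le> inverse (a\<^sup>2) * inverse (real j ^ 2)"
      by (simp add: power_mult_distrib mult.commute)
  qed
  then have nat: "(\<lambda>j. inverse ((1 + real j * a)\<^sup>2)) summable_on UNIV"
    by (rule norm_summable_imp_summable_on)
  have "?u summable_on range int"
    using nat assms by (subst summable_on_reindex) (auto simp: o_def)
  moreover have "?u summable_on range (\<lambda>j. - int j)"
    using nat assms by (subst summable_on_reindex) (auto simp: o_def inj_on_def)
  ultimately have "?u summable_on (range int \<union> range (\<lambda>j. - int j))"
    by (rule summable_on_union)
  moreover have "range int \<union> range (\<lambda>j. - int j) = UNIV"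
    by (auto simp: image_iff) (metis int_cases2)
  ultimately show ?thesis by simp
qed

text \<open>A finite set of lattice points lies in the finite rectangle spanned by its projections, where
  the double sum of \<open>u n * v k\<close> factorises.\<close>

lemma infsum_ennreal_product_bound:
  fixes u v :: "int \<Rightarrow> real"
  assumes u: "u summable_on UNIV" "\<And>n. 0 \<le> u n" and v: "v summable_on UNIV" "\<And>k. 0 \<le> v k"
    and f: "\<And>n k. f n k \<le> B * (u n * v k)" and B: "0 \<le> B"
  shows "(\<Sum>\<^sub>\<infinity>(n, k)\<in>UNIV. ennreal (f n k)) \<le> ennreal (B * (infsum u UNIV * infsum v UNIV))"
proof -
  have "sum (\<lambda>(n, k). ennreal (f n k)) F \<le> ennreal (B * (infsum u UNIV * infsum v UNIV))"
    if "finite F" for F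
  proof -
    have "sum (\<lambda>(n, k). ennreal (f n k)) F \<le> sum (\<lambda>(n, k). ennreal (B * (u n * v k))) F"
      using f by (intro sum_mono) (auto intro: ennreal_leI)
    also have "\<dots> = ennreal (\<Sum>(n, k)\<in>F. B * (u n * v k))"
      using u v B by (subst sum_ennreal[symmetric]) (auto simp: case_prod_unfold)
    also have "(\<Sum>(n, k)\<in>F. B * (u n * v k)) \<le> (\<Sum>(n, k)\<in>fst ` F \<times> snd ` F. B * (u n * v k))"
      using u v B that by (intro sum_mono2) (auto simp: image_iff Bex_def)
    also have "\<dots> = B * (sum u (fst ` F) * sum v (snd ` F))"
      unfolding sum_product sum.cartesian_product by (simp add: sum_distrib_left case_prod_unfold)
    also have "\<dots> \<le> B * (infsum u UNIV * infsum v UNIV)"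
      using u v B that
      by (intro mult_left_mono mult_mono finite_sum_le_infsum infsum_nonneg sum_nonneg) auto
    finally show ?thesis by (simp add: ennreal_leI)
  qed
  then show ?thesis
    by (subst nonneg_infsum_complete) (auto intro!: SUP_least)
qed

theorem proposition3p5:
  fixes g :: "real \<Rightarrow> complex" and s x0 y0 :: real and p :: ennreal
  assumes "x0 > 0" and "y0 > 0"
    and "g \<in> schwartz_space - {\<lambda>t. 0}"
    and "s \<ge> 0"
    and "1 \<le> p" and "p \<le> \<infinity>"
  shows "lp_weighted_norm p s x0 y0 (\<lambda>n k. l2_inner gaussian (tf_shift x0 y0 g n k)) < \<infinity>"
proof -
  define c where "c = (\<lambda>(n::int) (k::int). stft g gaussian (n * x0) (k * y0))"
  define u v where "u = (\<lambda>n::int. inverse ((1 + \<bar>of_int n * x0\<bar>)\<^sup>2))"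
    and "v = (\<lambda>k::int. inverse ((1 + \<bar>of_int k * y0\<bar>)\<^sup>2))"
  have "0 < inverse ((1 + \<bar>y\<bar>)\<^sup>2) \<and> inverse ((1 + \<bar>y\<bar>)\<^sup>2) \<le> 1" for y :: real
  proof -
    have "1 \<le> (1 + \<bar>y\<bar>)\<^sup>2" by (intro one_le_power) simp
    then show ?thesis
      by (smt (verit) inverse_le_1_iff inverse_positive_iff_positive)
  qed
  then have uv: "0 < u n" "u n \<le> 1" "0 < v n" "v n \<le> 1" for n
    unfolding u_def v_def by blast+
  have g: "g \<in> schwartz_space" using assms(3) by simp
  obtain C where C': "\<And>x \<omega>. cmod (stft g gaussian x \<omega>) * weight s x \<omega>
      \<le> C * inverse (((1 + \<bar>x\<bar>) * (1 + \<bar>\<omega>\<bar>))\<^sup>2)"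
    using weighted_stft_decay[OF gaussian_schwartz g, where s = s] by blast
  have C: "cmod (c n k) * weight s (n * x0) (k * y0) \<le> C * (u n * v k)" for n k
    using C'[of "n * x0" "k * y0"]
    by (simp only: c_def u_def v_def power_mult_distrib inverse_mult_distrib)
  have w0: "0 \<le> weight s x y" for x y by (simp add: weight_def)
  have C0: "0 \<le> C"
  proof -
    have "0 \<le> C * (u 0 * v 0)"
      by (rule order_trans[OF _ C]) (intro mult_nonneg_nonneg norm_ge_zero w0)
    then show ?thesis by (simp add: u_def v_def)
  qed
  have "lp_weighted_norm p s x0 y0 c < \<infinity>"
  proof (cases "p = \<infinity>")
    case True
    have "cmod (c n k) * weight s (n * x0) (k * y0) \<le> C" for n k
    proof -
      have "u n * v k \<le> 1" using uv[of n] uv[of k] by (intro mult_le_one) auto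
      then show ?thesis using C[of n k] C0 mult_left_mono[of "u n * v k" 1 C] by simp
    qed
    then have "lp_weighted_norm p s x0 y0 c \<le> ennreal C"
      using True by (auto simp: lp_weighted_norm_def intro!: SUP_least ennreal_leI)
    then show ?thesis by (simp add: le_less_trans)
  next
    case False
    define q where "q = enn2real p"
    have "p = ennreal q"
      using False by (simp add: q_def top.not_eq_extremum)
    then have q: "1 \<le> q"
      using assms(5) by (metis ennreal_1 ennreal_le_iff2 not_one_le_zero)
    define S where "S = (\<Sum>\<^sub>\<infinity>(n, k)\<in>UNIV.
        ennreal (cmod (c n k) powr q * weight s (of_int n * x0) (of_int k * y0) powr q))"
    have "S \<le> ennreal (C powr q * (infsum u UNIV * infsum v UNIV))"
      unfolding S_def
    proof (rule infsum_ennreal_product_bound)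
      show "u summable_on UNIV" "v summable_on UNIV"
        unfolding u_def v_def using assms(1,2) by (auto intro: summable_on_inverse_square_int)
      fix n k
      have "cmod (c n k) powr q * weight s (n * x0) (k * y0) powr q
          = (cmod (c n k) * weight s (n * x0) (k * y0)) powr q"
        using w0 by (simp add: powr_mult)
      also have "\<dots> \<le> (C * (u n * v k)) powr q"
        using C q w0 by (intro powr_mono2) auto
      also have "\<dots> = C powr q * (u n * v k) powr q"
        using C0 uv[of n] uv[of k] by (simp add: powr_mult)
      \<comment> \<open>A number in \<open>(0, 1]\<close> only shrinks under a power \<open>q \<ge> 1\<close>, so the summable majorant of
        the case \<open>q = 1\<close> serves for all finite exponents.\<close>
      also have "\<dots> \<le> C powr q * (u n * v k)"
        using uv[of n] uv[of k] q by (intro mult_left_mono powr_le_one_le mult_le_one) auto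
      finally show "cmod (c n k) powr q * weight s (n * x0) (k * y0) powr q
          \<le> C powr q * (u n * v k)" .
    qed (use uv in \<open>auto intro: less_imp_le\<close>)
    then have "S \<noteq> \<infinity>" by (auto simp: top_unique)
    then show ?thesis
      using False by (simp add: lp_weighted_norm_def flip: q_def S_def)
  qed
  then show ?thesis
    by (simp add: c_def l2_inner_tf_shift)
qed

end
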